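(* Let $(\mathcal{L}_{QA},\models)$ be a qualitative algebra over a finite set $\mathcal{V}$ of variables, let $\Omega$ be its set of consistent scenarios, and let $(\mathcal{L}_{QA}^{PC},\models)$ be its propositional closure. Then every set of scenarios $\Sigma\subseteq\Omega$ is representable in $\mathcal{L}_{QA}^{PC}$, i.e. there is $\varphi\in\mathcal{L}_{QA}^{PC}$ with $\mathrm{Mod}(\varphi)=\Sigma$. More precisely, with $\varphi=\bigvee_{\sigma\in\Sigma}\sigma$, one has $\mathrm{Mod}(\varphi)=\Sigma$.
   Context: Qualitative algebra (QA), syntax. $\mathcal{B}$ is a finite set of symbols with $|\mathcal{B}|\ge 2$, called base relations. A relation is an expression $r_1\,|\,\cdots\,|\,r_m$ ($m\ge 0$) of pairwise distinct base relations, order irrelevant (so a relation amounts to a subset of $\mathcal{B}$, possibly empty). $\mathcal{V}$ is a finite nonempty set of variables, disjoint from $\mathcal{B}$. A constraint is an expression $x\,r\,y$ with $x,y\in\mathcal{V}$ and $r$ a relation. A formula of $\mathcal{L}_{QA}$ is a conjunction of $n\ge 1$ constraints. A scenario is a formula which, for every ordered pair of distinct variables $x\ne y$, contains exactly one constraint $x\,r\,y$, with $r$ a base relation, and which has no other constraints; scenarios are identified up to the order of conjuncts. Semantics. A set $\mathcal{U}$ of subsets of some domain is fixed, and each base relation is interpreted as a binary relation on $\mathcal{U}$. The interpretations of the base relations are pairwise disjoint, their union is $\mathcal{U}\times\mathcal{U}$, and the converse of each base relation is a base relation. An interpretation $\mathcal{I}$ maps each variable to an element of $\mathcal{U}$.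 It satisfies $x\,(r_1\,|\,\cdots\,|\,r_m)\,y$ iff $(\mathcal{I}(x),\mathcal{I}(y))$ belongs to the interpretation of $r_k$ for some $k\in\{1,\dots,m\}$ (so never if $m=0$), and it satisfies a formula iff it satisfies all its constraints. A formula is consistent if some interpretation satisfies it. For $\varphi_1,\varphi_2\in\mathcal{L}_{QA}$, $\varphi_1\models\varphi_2$ means every interpretation satisfying $\varphi_1$ satisfies $\varphi_2$. $\Omega$ is the (finite) set of consistent scenarios, and for $\varphi\in\mathcal{L}_{QA}$, $\mathrm{Mod}(\varphi)=\{\sigma\in\Omega \mid \sigma\models\varphi\}$. Propositional closure. $\mathcal{L}_{QA}^{PC}$ is the smallest superset of $\mathcal{L}_{QA}$ closed under $\lnot$ and $\land$; $\varphi_1\lor\varphi_2$ abbreviates $\lnot(\lnot\varphi_1\land\lnot\varphi_2)$. $\mathrm{Mod}$ is extended by $\mathrm{Mod}(\varphi_1\land\varphi_2)=\mathrm{Mod}(\varphi_1)\cap\mathrm{Mod}(\varphi_2)$ and $\mathrm{Mod}(\lnot\varphi)=\Omega\setminus\mathrm{Mod}(\varphi)$, and on $\mathcal{L}_{QA}^{PC}$, $\varphi_1\models\varphi_2$ means $\mathrm{Mod}(\varphi_1)\subseteq\mathrm{Mod}(\varphi_2)$. An empty disjunction denotes an inconsistent formula, e.g. $x\,r\,x$ with $r$ the empty relation. *)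

theory Defs
  imports "HOL-Library.Multiset" "HOL-Library.Disjoint_Sets" "HOL-Library.FuncSet"
begin

text \<open>
  The set of variables and the set of base relations live in different types, so they are
  disjoint by construction. The domain is the type \<open>'d\<close>; the universe is any set of its subsets.
\<close>

record ('b, 'v, 'd) qa_data =
  base_rels :: "'b set"
  variables :: "'v set"
  universe :: "'d set set"
  interp :: "'b \<Rightarrow> ('d set \<times> 'd set) set"

locale qualitative_algebra =
  fixes Q :: "('b, 'v, 'd) qa_data"
  assumes finite_base: "finite (base_rels Q)"
    and card_base: "card (base_rels Q) \<ge> 2"
    and finite_variables: "finite (variables Q)"
    and variables_nonempty: "variables Q \<noteq> {}"
    and interp_disjoint: "disjoint_family_on (interp Q) (base_rels Q)"
    and interp_cover: "(\<Union>b\<in>base_rels Q. interp Q b) = universe Q \<times> universe Q"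
    and interp_converse: "\<forall>b\<in>base_rels Q. \<exists>b'\<in>base_rels Q. interp Q b' = (interp Q b)\<inverse>"

text \<open>
  The relation \<open>r\<^sub>1 | \<dots> | r\<^sub>m\<close> is the set of its base relations. A conjunction of constraints is
  the multiset of its conjuncts: repetitions count, the order of the conjuncts does not. In
  particular, equality of scenarios is equality up to the order of conjuncts.
\<close>

datatype ('b, 'v) qa_constraint = Constraint (lhs: 'v) (rel: "'b set") (rhs: 'v)

type_synonym ('b, 'v) qa_formula = "('b, 'v) qa_constraint multiset"

definition constraints :: "('b, 'v, 'd) qa_data \<Rightarrow> ('b, 'v) qa_constraint set" where
  "constraints Q = {c. lhs c \<in> variables Q \<and> rel c \<subseteq> base_rels Q \<and> rhs c \<in> variables Q}"

definition L_QA :: "('b, 'v, 'd) qa_data \<Rightarrow> ('b, 'v) qa_formula set" where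
  "L_QA Q = {\<phi>. \<phi> \<noteq> {#} \<and> set_mset \<phi> \<subseteq> constraints Q}"

text \<open>
  If there is only one variable, there is no scenario: a formula has at least one conjunct.
\<close>

definition scenario :: "('b, 'v, 'd) qa_data \<Rightarrow> ('b, 'v) qa_formula \<Rightarrow> bool" where
  "scenario Q \<phi> \<longleftrightarrow> \<phi> \<in> L_QA Q \<and>
     (\<forall>x\<in>variables Q. \<forall>y\<in>variables Q. x \<noteq> y \<longrightarrow>
        (\<exists>b\<in>base_rels Q. filter_mset (\<lambda>c. lhs c = x \<and> rhs c = y) \<phi> = {#Constraint x {b} y#})) \<and>
     (\<forall>c\<in>#\<phi>. lhs c \<noteq> rhs c)"

definition interpretations :: "('b, 'v, 'd) qa_data \<Rightarrow> ('v \<Rightarrow> 'd set) set" where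
  "interpretations Q = variables Q \<rightarrow> universe Q"

definition sat_constraint ::
    "('b, 'v, 'd) qa_data \<Rightarrow> ('v \<Rightarrow> 'd set) \<Rightarrow> ('b, 'v) qa_constraint \<Rightarrow> bool" where
  "sat_constraint Q I c \<longleftrightarrow> (\<exists>b\<in>rel c. (I (lhs c), I (rhs c)) \<in> interp Q b)"

definition satisfies ::
    "('b, 'v, 'd) qa_data \<Rightarrow> ('v \<Rightarrow> 'd set) \<Rightarrow> ('b, 'v) qa_formula \<Rightarrow> bool" where
  "satisfies Q I \<phi> \<longleftrightarrow> (\<forall>c\<in>#\<phi>. sat_constraint Q I c)"

definition consistent :: "('b, 'v, 'd) qa_data \<Rightarrow> ('b, 'v) qa_formula \<Rightarrow> bool" where
  "consistent Q \<phi> \<longleftrightarrow> (\<exists>I\<in>interpretations Q. satisfies Q I \<phi>)"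

definition entails ::
    "('b, 'v, 'd) qa_data \<Rightarrow> ('b, 'v) qa_formula \<Rightarrow> ('b, 'v) qa_formula \<Rightarrow> bool" where
  "entails Q \<phi> \<psi> \<longleftrightarrow> (\<forall>I\<in>interpretations Q. satisfies Q I \<phi> \<longrightarrow> satisfies Q I \<psi>)"

definition Omega :: "('b, 'v, 'd) qa_data \<Rightarrow> ('b, 'v) qa_formula set" where
  "Omega Q = {\<sigma>. scenario Q \<sigma> \<and> consistent Q \<sigma>}"

datatype ('b, 'v) pc_formula =
    QA "('b, 'v) qa_formula"
  | Neg "('b, 'v) pc_formula"
  | And "('b, 'v) pc_formula" "('b, 'v) pc_formula"

inductive_set L_QA_PC :: "('b, 'v, 'd) qa_data \<Rightarrow> ('b, 'v) pc_formula set"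
  for Q :: "('b, 'v, 'd) qa_data" where
  QA: "\<phi> \<in> L_QA Q \<Longrightarrow> QA \<phi> \<in> L_QA_PC Q"
| Neg: "\<phi> \<in> L_QA_PC Q \<Longrightarrow> Neg \<phi> \<in> L_QA_PC Q"
| And: "\<phi> \<in> L_QA_PC Q \<Longrightarrow> \<psi> \<in> L_QA_PC Q \<Longrightarrow> And \<phi> \<psi> \<in> L_QA_PC Q"

primrec Mod :: "('b, 'v, 'd) qa_data \<Rightarrow> ('b, 'v) pc_formula \<Rightarrow> ('b, 'v) qa_formula set" where
  "Mod Q (QA \<phi>) = {\<sigma> \<in> Omega Q. entails Q \<sigma> \<phi>}"
| "Mod Q (Neg \<phi>) = Omega Q - Mod Q \<phi>"
| "Mod Q (And \<phi> \<psi>) = Mod Q \<phi> \<inter> Mod Q \<psi>"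

text \<open>
  The conjunction of two formulas of \<open>L_QA\<close>, taken inside \<open>L_QA\<close>, and their conjunction in the
  closure are different terms with the same models.
\<close>

lemma Mod_QA_union: "Mod Q (QA (\<phi> + \<psi>)) = Mod Q (And (QA \<phi>) (QA \<psi>))"
  by (auto simp: entails_def satisfies_def)

definition Or :: "('b, 'v) pc_formula \<Rightarrow> ('b, 'v) pc_formula \<Rightarrow> ('b, 'v) pc_formula" where
  "Or \<phi> \<psi> = Neg (And (Neg \<phi>) (Neg \<psi>))"

fun big_or :: "('b, 'v) pc_formula \<Rightarrow> ('b, 'v) pc_formula list \<Rightarrow> ('b, 'v) pc_formula" where
  "big_or \<beta> [] = \<beta>"
| "big_or \<beta> [\<phi>] = \<phi>"
| "big_or \<beta> (\<phi> # \<psi> # \<phi>s) = Or \<phi> (big_or \<beta> (\<psi> # \<phi>s))"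

text \<open>
  The formulas denoted by the disjunction over a set \<open>\<Phi>\<close> of formulas: one for each order of the
  disjuncts and, if \<open>\<Phi>\<close> is empty, one for each inconsistent formula of \<open>L_QA\<close>. There is none if
  \<open>\<Phi>\<close> is infinite.
\<close>

definition disjunctions ::
    "('b, 'v, 'd) qa_data \<Rightarrow> ('b, 'v) pc_formula set \<Rightarrow> ('b, 'v) pc_formula set" where
  "disjunctions Q \<Phi> =
     {big_or (QA \<beta>) \<phi>s | \<beta> \<phi>s.
        \<beta> \<in> L_QA Q \<and> \<not> consistent Q \<beta> \<and> distinct \<phi>s \<and> set \<phi>s = \<Phi>}"

lemma empty_relation_inconsistent:
  assumes "x \<in> variables Q"
  shows "{#Constraint x {} x#} \<in> L_QA Q" "\<not> consistent Q {#Constraint x {} x#}"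
  using assms by (auto simp: L_QA_def constraints_def consistent_def satisfies_def sat_constraint_def)

definition representable :: "('b, 'v, 'd) qa_data \<Rightarrow> ('b, 'v) qa_formula set \<Rightarrow> bool" where
  "representable Q \<Sigma> \<longleftrightarrow> (\<exists>\<phi>\<in>L_QA_PC Q. Mod Q \<phi> = \<Sigma>)"

end

theory Submission
  imports Defs
begin

text \<open>
  A consistent scenario entails no scenario but itself: in a model of the first, the base relations
  that the two assign to a pair of variables intersect, so they coincide because base relations are
  disjoint. Hence the models of \<open>\<sigma>\<close> are \<open>{\<sigma>}\<close>, and those of a disjunction are its disjuncts.
\<close>

lemma satisfies_scenarios_imp_eq:
  fixes \<sigma> \<tau> :: "('b, 'v) qa_formula"
  assumes disj: "disjoint_family_on (interp Q) (base_rels Q)"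
    and "scenario Q \<sigma>" "scenario Q \<tau>" and sat: "satisfies Q I \<sigma>" "satisfies Q I \<tau>"
  shows "\<sigma> = \<tau>"
proof (rule multiset_eqI)
  fix c :: "('b, 'v) qa_constraint"
  \<comment> \<open>Since \<open>c\<close> itself satisfies \<open>?P\<close>, filtering by
    \<open>?P\<close> keeps its count, so only the conjuncts on the ordered pair
    \<open>(lhs c, rhs c)\<close> need to be compared.\<close>
  let ?P = "\<lambda>c'. lhs c' = lhs c \<and> rhs c' = rhs c"
  show "count \<sigma> c = count \<tau> c"
  proof (cases "lhs c \<in> variables Q \<and> rhs c \<in> variables Q \<and> lhs c \<noteq> rhs c")
    case True
    then obtain b b' where b: "b \<in> base_rels Q" "filter_mset ?P \<sigma> = {#Constraint (lhs c) {b} (rhs c)#}"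
      and b': "b' \<in> base_rels Q" "filter_mset ?P \<tau> = {#Constraint (lhs c) {b'} (rhs c)#}"
      using assms(2,3) unfolding scenario_def by meson
    have "Constraint (lhs c) {b} (rhs c) \<in># filter_mset ?P \<sigma>"
      "Constraint (lhs c) {b'} (rhs c) \<in># filter_mset ?P \<tau>"
      unfolding b(2) b'(2) by simp_all
    then have "Constraint (lhs c) {b} (rhs c) \<in># \<sigma>" "Constraint (lhs c) {b'} (rhs c) \<in># \<tau>"
      by simp_all
    then have "(I (lhs c), I (rhs c)) \<in> interp Q b \<inter> interp Q b'"
      using sat unfolding satisfies_def sat_constraint_def by fastforce
    then have "b = b'"
      using disj b(1) b'(1) by (auto simp: disjoint_family_on_def)
    then have "filter_mset ?P \<sigma> = filter_mset ?P \<tau>"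
      using b b' by simp
    then have "count (filter_mset ?P \<sigma>) c = count (filter_mset ?P \<tau>) c"
      by simp
    then show ?thesis
      by simp
  next
    \<comment> \<open>Every conjunct of a scenario joins two distinct variables of \<open>Q\<close>,
      so here both counts are zero.\<close>
    case False
    then have "c \<notin># \<sigma>" "c \<notin># \<tau>"
      using assms(2,3) by (auto simp: scenario_def L_QA_def constraints_def)
    then show ?thesis
      by (simp add: not_in_iff)
  qed
qed

text \<open>Consistency of \<sigma> supplies an interpretation satisfying it; entailment makes the
  same interpretation satisfy \<tau>.\<close>

lemma (in qualitative_algebra) entails_scenario_iff_eq:
  assumes "\<sigma> \<in> Omega Q" "scenario Q \<tau>"
  shows "entails Q \<sigma> \<tau> \<longleftrightarrow> \<sigma> = \<tau>"
  using assms satisfies_scenarios_imp_eq[OF interp_disjoint]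
  by (auto simp: Omega_def consistent_def entails_def)

lemma (in qualitative_algebra) Mod_scenario:
  assumes "\<sigma> \<in> Omega Q"
  shows "Mod Q (QA \<sigma>) = {\<sigma>}"
  using assms entails_scenario_iff_eq by (auto simp: Omega_def)

lemma (in qualitative_algebra) finite_constraints: "finite (constraints Q)"
proof (rule finite_subset)
  show "constraints Q \<subseteq> (\<lambda>(x, r, y). Constraint x r y) `
      (variables Q \<times> Pow (base_rels Q) \<times> variables Q)"
  proof
    fix c
    assume "c \<in> constraints Q"
    then show "c \<in> (\<lambda>(x, r, y). Constraint x r y) `
        (variables Q \<times> Pow (base_rels Q) \<times> variables Q)"
      by (cases c) (auto simp: constraints_def image_iff)
  qed
qed (simp add: finite_variables finite_base)

text \<open>The conjuncts on one ordered pair form a singleton multiset, so no conjunct is repeated.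
  This is what bounds the number of scenarios: a finite nonempty set of constraints still carries
  infinitely many multisets.\<close>

lemma scenario_eq_mset_set:
  fixes \<sigma> :: "('b, 'v) qa_formula"
  assumes "scenario Q \<sigma>"
  shows "\<sigma> = mset_set (set_mset \<sigma>)"
proof (rule multiset_eqI)
  fix c :: "('b, 'v) qa_constraint"
  let ?P = "\<lambda>c'. lhs c' = lhs c \<and> rhs c' = rhs c"
  show "count \<sigma> c = count (mset_set (set_mset \<sigma>)) c"
  proof (cases "c \<in># \<sigma>")
    case True
    then have "lhs c \<in> variables Q" "rhs c \<in> variables Q" "lhs c \<noteq> rhs c"
      using assms by (auto simp: scenario_def L_QA_def constraints_def)
    then obtain b where "filter_mset ?P \<sigma> = {#Constraint (lhs c) {b} (rhs c)#}"
      using assms unfolding scenario_def by meson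
    then have "count (filter_mset ?P \<sigma>) c \<le> 1"
      by simp
    then show ?thesis
      using True by (simp add: count_greater_zero_iff[symmetric] del: count_greater_zero_iff)
  next
    case False
    then show ?thesis
      by (simp add: not_in_iff)
  qed
qed

lemma (in qualitative_algebra) finite_Omega: "finite (Omega Q)"
proof (rule finite_subset)
  show "Omega Q \<subseteq> mset_set ` Pow (constraints Q)"
  proof
    fix \<sigma>
    assume "\<sigma> \<in> Omega Q"
    then have "scenario Q \<sigma>"
      by (simp add: Omega_def)
    then have "\<sigma> = mset_set (set_mset \<sigma>)" "set_mset \<sigma> \<in> Pow (constraints Q)"
      using scenario_eq_mset_set by (auto simp: scenario_def L_QA_def)
    then show "\<sigma> \<in> mset_set ` Pow (constraints Q)"
      by (rule image_eqI)
  qed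
qed (simp add: finite_constraints)

text \<open>Negation is a complement relative to \<open>Omega Q\<close>, so double complements
  cancel only for subsets of \<open>Omega Q\<close>; De Morgan in \<open>Mod_Or\<close> rests on
  this.\<close>

lemma Mod_subset_Omega: "Mod Q \<phi> \<subseteq> Omega Q"
  by (induction \<phi>) auto

lemma Mod_Or: "Mod Q (Or \<phi> \<psi>) = Mod Q \<phi> \<union> Mod Q \<psi>"
  using Mod_subset_Omega[of Q \<phi>] Mod_subset_Omega[of Q \<psi>] by (auto simp: Or_def)

text \<open>Each member of \<open>Omega Q\<close> has a satisfying interpretation, which entailment
  would pass on to \<beta>.\<close>

lemma Mod_inconsistent:
  assumes "\<not> consistent Q \<beta>"
  shows "Mod Q (QA \<beta>) = {}"
  using assms by (auto simp: Omega_def consistent_def entails_def)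

text \<open>The assumption on \<beta> settles the empty list, where \<open>big_or\<close> returns
  \<beta> and the union is empty.\<close>

lemma Mod_big_or:
  assumes "Mod Q \<beta> = {}"
  shows "Mod Q (big_or \<beta> \<phi>s) = (\<Union>\<phi>\<in>set \<phi>s. Mod Q \<phi>)"
  using assms by (induction \<beta> \<phi>s rule: big_or.induct) (simp_all add: Mod_Or)

lemma big_or_in_L_QA_PC:
  assumes "\<beta> \<in> L_QA_PC Q" "set \<phi>s \<subseteq> L_QA_PC Q"
  shows "big_or \<beta> \<phi>s \<in> L_QA_PC Q"
  using assms
  by (induction \<beta> \<phi>s rule: big_or.induct) (simp_all add: Or_def L_QA_PC.Neg L_QA_PC.And)

text \<open>This keeps a claim about all members of \<open>disjunctions\<close> from being vacuous.
  Finiteness provides a list of the disjuncts, and a variable \<open>x\<close> provides the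
  inconsistent formula \<open>{#Constraint x {} x#}\<close>.\<close>

lemma (in qualitative_algebra) disjunctions_nonempty:
  assumes "finite \<Phi>"
  shows "disjunctions Q \<Phi> \<noteq> {}"
proof -
  obtain x where "x \<in> variables Q"
    using variables_nonempty by blast
  moreover obtain \<phi>s where "distinct \<phi>s" "set \<phi>s = \<Phi>"
    using finite_distinct_list[OF assms] by blast
  ultimately show ?thesis
    using empty_relation_inconsistent[of x Q] unfolding disjunctions_def by blast
qed

lemma (in qualitative_algebra) disjunction_of_scenarios:
  assumes "\<Sigma> \<subseteq> Omega Q" "\<phi> \<in> disjunctions Q (QA ` \<Sigma>)"
  shows "\<phi> \<in> L_QA_PC Q" "Mod Q \<phi> = \<Sigma>"
proof -
  obtain \<beta> \<phi>s where \<phi>: "\<phi> = big_or (QA \<beta>) \<phi>s" "\<beta> \<in> L_QA Q" "\<not> consistent Q \<beta>" "set \<phi>s = QA ` \<Sigma>"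
    using assms(2) unfolding disjunctions_def by blast
  have "\<Sigma> \<subseteq> L_QA Q"
    using assms(1) by (auto simp: Omega_def scenario_def)
  then show "\<phi> \<in> L_QA_PC Q"
    unfolding \<phi>(1) using \<phi>(2,4) by (intro big_or_in_L_QA_PC) (auto intro: L_QA_PC.QA)
  have "Mod Q \<phi> = (\<Union>\<sigma>\<in>\<Sigma>. Mod Q (QA \<sigma>))"
    unfolding \<phi>(1) Mod_big_or[OF Mod_inconsistent[OF \<phi>(3)]] \<phi>(4) by simp
  also have "\<dots> = (\<Union>\<sigma>\<in>\<Sigma>. {\<sigma>})"
    using assms(1) Mod_scenario by (intro SUP_cong refl) blast
  finally show "Mod Q \<phi> = \<Sigma>"
    by simp
qed

theorem proposition1:
  fixes Q :: "('b, 'v, 'd) qa_data"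
    and \<Sigma> :: "('b, 'v) qa_formula set"
  assumes "qualitative_algebra Q"
    and "\<Sigma> \<subseteq> Omega Q"
  shows "representable Q \<Sigma> \<and>
         disjunctions Q (QA ` \<Sigma>) \<noteq> {} \<and>
         (\<forall>\<phi>\<in>disjunctions Q (QA ` \<Sigma>). \<phi> \<in> L_QA_PC Q \<and> Mod Q \<phi> = \<Sigma>)"
proof -
  interpret qualitative_algebra Q
    by (fact assms(1))
  have "finite (QA ` \<Sigma>)"
    using finite_subset[OF assms(2) finite_Omega] by simp
  then have "disjunctions Q (QA ` \<Sigma>) \<noteq> {}"
    by (rule disjunctions_nonempty)
  \<comment> \<open>Any member of this nonempty set witnesses representability.\<close>
  then show ?thesis
    using disjunction_of_scenarios[OF assms(2)] unfolding representable_def by blast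
qed

end
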